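(* Let $n\ge1$. Let $X_1\in H_2=\mathrm{Herm}(n)$ be drawn from the P\'olya ensemble on $H_2$ associated to the weight $\omega\in L^1_{\mathcal F}(\mathbb R)$ and let $X_2\in H_2$ be a random matrix, independent of $X_1$, drawn from a polynomial ensemble on $H_2$ associated with the weights $w_1,\ldots,w_n$. Suppose the polynomial ensemble of $X_2$ can be described by the bi-orthonormal functions $\{\tilde p_j,w_{j+1}\}_{j=0,\ldots,n-1}$, with kernel $\tilde K_n(y',y)=\sum_{j=0}^{n-1}\tilde p_j(y')w_{j+1}(y)$. Consider the joint probability density $$p_D^{(w)}(y)=\frac{C_n[w]}{n!(\mathcal F\omega(0))^n}\Delta_n(y)\det[\omega\ast w_b(y_a)]_{a,b=1,\ldots,n}$$ of the eigenvalues $y\in\mathbb R^n$ of $Y=X_1+X_2$. Then the pair of bi-orthonormal functions on $\mathbb R$ corresponding to $Y$ (i.e. describing this density) is $$p_j(y')=\int_0^\infty dr\,e^{-r}\left.\frac{(r-\imath\partial_t\partial_{y'})^{n-1}}{(n-1)!}\frac{\tilde p_j(y')}{\mathcal F\omega(t)}\right|_{t=0},\qquad q_j(y)=\omega\ast w_{j+1}(y),\qquad j=0,\ldots,n-1,$$ and the corresponding kernel is $$K_n(y',y)=\int_{-\infty}^\infty d\hat y\int_0^\infty dr\,e^{-r}\,\omega(y-\hat y)\left.\frac{(r-\imath\partial_t\partial_{y'})^{n-1}}{(n-1)!}\frac{\tilde K_n(y',\hat y)}{\mathcal F\omega(t)}\right|_{t=0}.$$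
   Context: Notation: $\imath=\sqrt{-1}$; $\Delta_n(x)=\prod_{1\le b<c\le n}(x_c-x_b)$; $\mathcal F f(s)=\int_{-\infty}^\infty f(x)e^{\imath xs}dx$; $\omega\ast\sigma(x)=\int_{-\infty}^\infty\omega(y)\sigma(x-y)dy$. $L^1_{[1,n]}(\mathbb R)$ is the set of $f\in L^1(\mathbb R)$ with $\int|x^{\kappa-1}f(x)|dx<\infty$ for all $\kappa\in[1,n]$. $L^1_{\mathcal F}(\mathbb R)$ is the set of $f\in L^1(\mathbb R)$ that are non-negative, $(n-1)$-times differentiable and satisfy $\int_{-\infty}^\infty |x^{\kappa-1}f^{(j)}(x)|dx<\infty$ for all $\kappa\in[1,n]$ and $j=0,\ldots,n-1$. Polynomial ensemble on $H_2$ associated with weights $w_1,\ldots,w_n\in L^1_{[1,n]}(\mathbb R)$: a random Hermitian $n\times n$ matrix whose law has a density (with respect to Lebesgue measure) invariant under conjugation by $\mathrm U(n)$, and whose unordered eigenvalues have joint probability density $\frac{C_n[w]}{n!}\Delta_n(a)\det[w_b(a_c)]_{b,c=1}^n\ge0$ on $\mathbb R^n$, with normalization constant $C_n[w]>0$. A P\'olya ensemble on $H_2$ with associated weight $\omega\in L^1_{\mathcal F}(\mathbb R)$ is a polynomial ensemble with $w_j=(-\partial_x)^{j-1}\omega$, $j=1,\ldots,n$. Description by bi-orthonormal functions: a polynomial ensemble with weights $v_1,\ldots,v_n$ (density proportional to $\Delta_n(y)\det[v_b(y_c)]$) is described by $\{p_j,q_j\}_{j=0,\ldots,n-1}$ if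 $\int_{\mathbb R}p_l(y)q_m(y)dy=\delta_{lm}$ for $l,m=0,\ldots,n-1$, the linear span of $\{p_j\}$ equals that of $\{y^j\}_{j=0,\ldots,n-1}$, and the linear span of $\{q_j\}$ equals that of $\{v_{j+1}\}_{j=0,\ldots,n-1}$. The corresponding kernel is $\sum_{j=0}^{n-1}p_j(y')q_j(y)$. In the formulas, $\partial_t$ acts on $1/\mathcal F\omega(t)$ and $\partial_{y'}$ acts on $\tilde p_j(y')$ or $\tilde K_n(y',\hat y)$. *)

theory Defs
  imports
    "HOL-Probability.Probability"
    "Jordan_Normal_Form.Char_Poly"
    "Jordan_Normal_Form.Schur_Decomposition"
begin

definition fourier :: "(real \<Rightarrow> real) \<Rightarrow> real \<Rightarrow> complex" where
  "fourier f s = (LINT x|lborel. complex_of_real (f x) * exp (\<i> * complex_of_real (x * s)))"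

definition conv :: "(real \<Rightarrow> real) \<Rightarrow> (real \<Rightarrow> complex) \<Rightarrow> real \<Rightarrow> complex" where
  "conv f g x = (LINT y|lborel. complex_of_real (f y) * g (x - y))"

text \<open>The exponent \<open>\<kappa>\<close> ranges over the real interval \<open>[1,n]\<close>, and \<open>|x\<^sup>\<kappa>\<^sup>-\<^sup>1|\<close> is read as
  \<open>|x|\<^sup>\<kappa>\<^sup>-\<^sup>1\<close>. The convention \<open>0 powr 0 = 0\<close> only matters on the null set \<open>{0}\<close>.\<close>

definition L1_moments :: "nat \<Rightarrow> (real \<Rightarrow> 'b::{banach, second_countable_topology}) set" where
  "L1_moments n = {f. integrable lborel f \<and>
     (\<forall>\<kappa>\<in>{1..real n}. integrable lborel (\<lambda>x. (\<bar>x\<bar> powr (\<kappa> - 1)) *\<^sub>R f x))}"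

definition L1_F :: "nat \<Rightarrow> (real \<Rightarrow> real) set" where
  "L1_F n = {f. integrable lborel f \<and> (\<forall>x. 0 \<le> f x) \<and>
     (\<forall>j. j + 1 < n \<longrightarrow> (\<forall>x. (deriv ^^ j) f differentiable (at x))) \<and>
     (\<forall>\<kappa>\<in>{1..real n}. \<forall>j<n.
        integrable lborel (\<lambda>x. (\<bar>x\<bar> powr (\<kappa> - 1)) * (deriv ^^ j) f x))}"

definition lin_span :: "'i set \<Rightarrow> ('i \<Rightarrow> real \<Rightarrow> complex) \<Rightarrow> (real \<Rightarrow> complex) set" where
  "lin_span I f = {g. \<exists>c. \<forall>y. g y = (\<Sum>j\<in>I. c j * f j y)}"

definition herm :: "nat \<Rightarrow> complex mat set" where
  "herm n = {A \<in> carrier_mat n n. mat_adjoint A = A}"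

definition unitary_mats :: "nat \<Rightarrow> complex mat set" where
  "unitary_mats n = {U \<in> carrier_mat n n. U * mat_adjoint U = 1\<^sub>m n}"

text \<open>Real coordinates on the Hermitian matrices: \<open>x (i,i)\<close> is the \<open>i\<close>-th diagonal entry, and for
  \<open>i < j\<close> the numbers \<open>x (i,j)\<close> and \<open>x (j,i)\<close> are the real and imaginary part of the entry
  \<open>(i,j)\<close>.\<close>

definition herm_of_coords :: "nat \<Rightarrow> (nat \<times> nat \<Rightarrow> real) \<Rightarrow> complex mat" where
  "herm_of_coords n x = mat n n (\<lambda>(i,j).
     if i = j then complex_of_real (x (i,i))
     else if i < j then Complex (x (i,j)) (x (j,i))
     else Complex (x (j,i)) (- x (i,j)))"

definition herm_borel :: "nat \<Rightarrow> complex mat measure" where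
  "herm_borel n = vimage_algebra (herm n) (\<lambda>A. \<lambda>ij\<in>{..<n} \<times> {..<n}. A $$ ij)
     (\<Pi>\<^sub>M ij\<in>{..<n} \<times> {..<n}. borel)"

definition herm_lebesgue :: "nat \<Rightarrow> complex mat measure" where
  "herm_lebesgue n =
     distr (\<Pi>\<^sub>M ij\<in>{..<n} \<times> {..<n}. lborel) (herm_borel n) (herm_of_coords n)"

lemma herm_of_coords_in_herm: "herm_of_coords n x \<in> herm n"
  unfolding herm_def herm_of_coords_def mat_adjoint_def
  by (auto intro!: eq_matI simp: mat_of_rows_def complex_eq_iff)

lemma measurable_herm_of_coords:
  "herm_of_coords n \<in> (\<Pi>\<^sub>M ij\<in>{..<n} \<times> {..<n}. lborel) \<rightarrow>\<^sub>M herm_borel n"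
  unfolding herm_borel_def
proof (rule measurable_vimage_algebra2)
  show "herm_of_coords n \<in> space (\<Pi>\<^sub>M ij\<in>{..<n} \<times> {..<n}. lborel) \<rightarrow> herm n"
    using herm_of_coords_in_herm by auto
  show "(\<lambda>x. \<lambda>ij\<in>{..<n} \<times> {..<n}. herm_of_coords n x $$ ij)
      \<in> (\<Pi>\<^sub>M ij\<in>{..<n} \<times> {..<n}. lborel) \<rightarrow>\<^sub>M (\<Pi>\<^sub>M ij\<in>{..<n} \<times> {..<n}. borel)"
  proof (rule measurable_restrict)
    fix ij :: "nat \<times> nat" assume ij: "ij \<in> {..<n} \<times> {..<n}"
    obtain i j where [simp]: "ij = (i, j)" by (cases ij)
    have c: "(\<lambda>x. x k) \<in> borel_measurable (\<Pi>\<^sub>M ij\<in>{..<n} \<times> {..<n}. lborel :: real measure)"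
      if "k \<in> {..<n} \<times> {..<n}" for k :: "nat \<times> nat"
      using measurable_component_singleton[OF that, of "\<lambda>_. lborel :: real measure"] by simp
    have [measurable]:
      "(\<lambda>x. x (i,i)) \<in> borel_measurable (\<Pi>\<^sub>M ij\<in>{..<n} \<times> {..<n}. lborel :: real measure)"
      "(\<lambda>x. x (i,j)) \<in> borel_measurable (\<Pi>\<^sub>M ij\<in>{..<n} \<times> {..<n}. lborel :: real measure)"
      "(\<lambda>x. x (j,i)) \<in> borel_measurable (\<Pi>\<^sub>M ij\<in>{..<n} \<times> {..<n}. lborel :: real measure)"
      using ij by (auto intro!: c)
    have entry: "(\<lambda>x. herm_of_coords n x $$ ij) = (\<lambda>x.
        if i = j then complex_of_real (x (i,i))
        else if i < j then complex_of_real (x (i,j)) + \<i> * complex_of_real (x (j,i))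
        else complex_of_real (x (j,i)) + \<i> * complex_of_real (- x (i,j)))"
      using ij by (auto simp: herm_of_coords_def Complex_eq)
    show "(\<lambda>x. herm_of_coords n x $$ ij) \<in> borel_measurable (\<Pi>\<^sub>M ij\<in>{..<n} \<times> {..<n}. lborel)"
      unfolding entry by measurable
  qed
qed

text \<open>All orderings \<open>(a\<^sub>1,\<dots>,a\<^sub>n)\<close> of the eigenvalues, counted with multiplicity, as points of the
  product space over \<open>{1..n}\<close>.\<close>

definition eigenvalue_tuples :: "nat \<Rightarrow> complex mat \<Rightarrow> (nat \<Rightarrow> real) set" where
  "eigenvalue_tuples n A =
     {a \<in> extensional {1..n}. char_poly A = (\<Prod>i\<in>{1..n}. [:- complex_of_real (a i), 1:])}"

text \<open>Joint density of the unordered eigenvalues, for functions \<open>\<rho>\<close> that are symmetric in their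
  arguments (as all those below are). The law of an unordered tuple is its restriction to the
  permutation-invariant events. Weights are elements of \<open>L\<^sup>1\<close>, so non-negativity of the density is
  required almost everywhere; the order on the complex numbers makes \<open>0 \<le> \<rho> a\<close> include that
  \<open>\<rho> a\<close> is real.\<close>

definition has_eigenvalue_density ::
  "nat \<Rightarrow> 'a measure \<Rightarrow> ('a \<Rightarrow> complex mat) \<Rightarrow> ((nat \<Rightarrow> real) \<Rightarrow> complex) \<Rightarrow> bool" where
  "has_eigenvalue_density n M X \<rho> \<longleftrightarrow>
     \<rho> \<in> borel_measurable (\<Pi>\<^sub>M i\<in>{1..n}. lborel) \<and>
     (AE a in \<Pi>\<^sub>M i\<in>{1..n}. lborel. 0 \<le> \<rho> a) \<and>
     (\<forall>B \<in> sets (\<Pi>\<^sub>M i\<in>{1..n}. lborel).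
        (\<forall>a\<in>B. \<forall>\<pi>. \<pi> permutes {1..n} \<longrightarrow> a \<circ> \<pi> \<in> B) \<longrightarrow>
        emeasure M {x \<in> space M. eigenvalue_tuples n (X x) \<subseteq> B} =
          (\<integral>\<^sup>+ a\<in>B. ennreal (Re (\<rho> a)) \<partial>(\<Pi>\<^sub>M i\<in>{1..n}. lborel)))"

definition vandermonde :: "nat \<Rightarrow> (nat \<Rightarrow> real) \<Rightarrow> real" where
  "vandermonde n x = (\<Prod>c\<in>{1..n}. \<Prod>b\<in>{1..<c}. x c - x b)"

text \<open>Weights and arguments are numbered from \<open>1\<close> to \<open>n\<close>, matrix entries from \<open>0\<close> to \<open>n - 1\<close>.\<close>

definition weight_det :: "nat \<Rightarrow> (nat \<Rightarrow> real \<Rightarrow> complex) \<Rightarrow> (nat \<Rightarrow> real) \<Rightarrow> complex" where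
  "weight_det n w a = Determinant.det (Matrix.mat n n (\<lambda>(b,c). w (Suc b) (a (Suc c))))"

definition norm_const :: "nat \<Rightarrow> (nat \<Rightarrow> real \<Rightarrow> complex) \<Rightarrow> complex" where
  "norm_const n w = fact n /
     (LINT a|(\<Pi>\<^sub>M i\<in>{1..n}. lborel). complex_of_real (vandermonde n a) * weight_det n w a)"

definition ensemble_density ::
  "nat \<Rightarrow> complex \<Rightarrow> (nat \<Rightarrow> real \<Rightarrow> complex) \<Rightarrow> (nat \<Rightarrow> real) \<Rightarrow> complex" where
  "ensemble_density n C w a = C / fact n * complex_of_real (vandermonde n a) * weight_det n w a"

definition polynomial_ensemble ::
  "nat \<Rightarrow> 'a measure \<Rightarrow> ('a \<Rightarrow> complex mat) \<Rightarrow> (nat \<Rightarrow> real \<Rightarrow> complex) \<Rightarrow> bool" where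
  "polynomial_ensemble n M X w \<longleftrightarrow>
     (\<forall>j\<in>{1..n}. w j \<in> L1_moments n) \<and>
     (\<exists>f. distributed M (herm_lebesgue n) X f \<and>
        (\<forall>U\<in>unitary_mats n. \<forall>A\<in>herm n. f (U * A * mat_adjoint U) = f A)) \<and>
     0 < norm_const n w \<and>
     has_eigenvalue_density n M X (ensemble_density n (norm_const n w) w)"

definition polya_weights :: "(real \<Rightarrow> real) \<Rightarrow> nat \<Rightarrow> real \<Rightarrow> complex" where
  "polya_weights \<omega> j x = complex_of_real (((\<lambda>f y. - deriv f y) ^^ (j - 1)) \<omega> x)"

definition polya_ensemble ::
  "nat \<Rightarrow> 'a measure \<Rightarrow> ('a \<Rightarrow> complex mat) \<Rightarrow> (real \<Rightarrow> real) \<Rightarrow> bool" where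
  "polya_ensemble n M X \<omega> \<longleftrightarrow>
     \<omega> \<in> L1_F n \<and> polynomial_ensemble n M X (polya_weights \<omega>)"

definition described_by ::
  "nat \<Rightarrow> (nat \<Rightarrow> real \<Rightarrow> complex) \<Rightarrow> (nat \<Rightarrow> real \<Rightarrow> complex) \<Rightarrow> (nat \<Rightarrow> real \<Rightarrow> complex) \<Rightarrow> bool" where
  "described_by n v p q \<longleftrightarrow>
     (\<forall>l<n. \<forall>m<n. has_bochner_integral lborel (\<lambda>y. p l y * q m y) (if l = m then 1 else 0)) \<and>
     lin_span {..<n} p = lin_span {..<n} (\<lambda>j y. complex_of_real y ^ j) \<and>
     lin_span {..<n} q = lin_span {..<n} (\<lambda>j. v (j + 1))"

definition kernel ::
  "nat \<Rightarrow> (nat \<Rightarrow> real \<Rightarrow> complex) \<Rightarrow> (nat \<Rightarrow> real \<Rightarrow> complex) \<Rightarrow> real \<Rightarrow> real \<Rightarrow> complex" where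
  "kernel n p q y' y = (\<Sum>j<n. p j y' * q j y)"

definition diff_op :: "real \<Rightarrow> (real \<Rightarrow> real \<Rightarrow> complex) \<Rightarrow> real \<Rightarrow> real \<Rightarrow> complex" where
  "diff_op r f t y = complex_of_real r * f t y -
     \<i> * vector_derivative (\<lambda>s. vector_derivative (\<lambda>z. f s z) (at y)) (at t)"

end

theory Submission
  imports Defs
begin

text \<open>Write \<open>F\<close> for the Fourier transform of \<open>\<omega>\<close> and \<open>D\<close> for differentiation of polynomials.
  The functions \<open>P\<^sub>j\<close> that describe the second ensemble are polynomials of degree below \<open>n\<close>. On such
  polynomials a power series in \<open>D\<close> acts through its terms of order below \<open>n\<close>, so that
  \<open>n - 1\<close> derivatives of \<open>F\<close>, that is, \<open>n - 1\<close> moments of \<open>\<omega>\<close>, suffice. Two operators are at work.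

  Averaging against \<open>\<omega>\<close>, that is \<open>P \<mapsto> \<integral> P (x + z) \<omega> x dx\<close>, equals \<open>F(-\<i> D)\<close>, because the moments
  of \<open>\<omega>\<close> are the Taylor coefficients of \<open>F\<close> up to powers of \<open>\<i>\<close>. By Fubini, integrating \<open>P\<close> against
  \<open>\<omega> \<star> w\<close> is the same as integrating the average of \<open>P\<close> against \<open>w\<close>
  (\<open>has_bochner_integral_poly_conv\<close>).

  The formula for \<open>p\<^sub>j\<close> is the operator \<open>(1 / F)(-\<i> D)\<close> applied to \<open>P\<^sub>j\<close>: expand
  \<open>(r - \<i> \<partial>\<^sub>t \<partial>\<^sub>y)\<^sup>n\<^sup>-\<^sup>1\<close> binomially and integrate over \<open>r\<close>; the Gamma integrals leave exactly the
  Taylor series of \<open>1 / F\<close> at \<open>0\<close>, cut off at order \<open>n\<close> (\<open>integral_exp_diff_op\<close>). Here \<open>F 0 \<noteq> 0\<close>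
  since the normalization constant of the Polya ensemble is nonzero (\<open>fourier_0_nonzero\<close>).

  The two operators are inverse to each other (\<open>deriv_series_inverse\<close>). Hence integrating \<open>p\<^sub>j\<close> against
  \<open>\<omega> \<star> w\<^sub>k\<close> reduces to the given bi-orthonormality of \<open>P\<^sub>j\<close> and \<open>w\<^sub>k\<close>, and the \<open>p\<^sub>j\<close> still span the
  polynomials of degree below \<open>n\<close>. The kernel formula follows because \<open>(1 / F)(-\<i> D)\<close> is linear and
  can be applied to the kernel in its first argument, for each fixed value of the second; the
  finite sum is exchanged with the integral over that second argument.\<close>

section \<open>Reciprocals of exponential generating functions\<close>

text \<open>Pascal's rule in summed form. It drives both inductions below that differentiate a
  product repeatedly.\<close>

lemma sum_binomial_Suc:
  fixes b :: "nat \<Rightarrow> 'a::comm_semiring_1"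
  shows "(\<Sum>l\<le>Suc k. of_nat (Suc k choose l) * b l) =
    (\<Sum>l\<le>k. of_nat (k choose l) * b l) + (\<Sum>l\<le>k. of_nat (k choose l) * b (Suc l))"
proof -
  have "(\<Sum>l\<le>Suc k. of_nat (Suc k choose l) * b l) =
      b 0 + (\<Sum>l\<le>k. of_nat (Suc k choose Suc l) * b (Suc l))"
    by (simp add: sum.atMost_Suc_shift del: sum.atMost_Suc)
  also have "\<dots> = b 0 + (\<Sum>l\<le>k. of_nat (k choose Suc l) * b (Suc l))
      + (\<Sum>l\<le>k. of_nat (k choose l) * b (Suc l))"
    by (simp add: algebra_simps sum.distrib)
  also have "b 0 + (\<Sum>l\<le>k. of_nat (k choose Suc l) * b (Suc l)) =
      (\<Sum>l\<le>Suc k. of_nat (k choose l) * b l)"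
    by (simp add: sum.atMost_Suc_shift del: sum.atMost_Suc)
  also have "\<dots> = (\<Sum>l\<le>k. of_nat (k choose l) * b l)"
    by (simp add: binomial_eq_0)
  finally show ?thesis .
qed

text \<open>If \<open>a 0 \<noteq> 0\<close> and \<open>A(X) = \<Sum> a k X\<^sup>k / k!\<close>, then \<open>egf_inverse a\<close> is the coefficient
  sequence of \<open>1 / A\<close> in the same normalization. For \<open>a k = F\<^sup>(\<^sup>k\<^sup>)(t)\<close> these are the
  derivatives of \<open>1 / F\<close> at \<open>t\<close>; the recursion is the Leibniz rule for \<open>F \<cdot> (1 / F) = 1\<close>
  solved for the highest derivative of \<open>1 / F\<close>.\<close>

fun egf_inverse :: "(nat \<Rightarrow> 'a::field_char_0) \<Rightarrow> nat \<Rightarrow> 'a" where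
  "egf_inverse a m =
    ((if m = 0 then 1 else 0) - (\<Sum>k<m. of_nat (m choose k) * a (m - k) * egf_inverse a k)) / a 0"

declare egf_inverse.simps [simp del]

lemma egf_inverse_conv:
  assumes "a 0 \<noteq> 0"
  shows "(\<Sum>k\<le>m. of_nat (m choose k) * a (m - k) * egf_inverse a k) = (if m = 0 then 1 else 0)"
proof -
  have "{..m} = insert m {..<m}" by auto
  then have "(\<Sum>k\<le>m. of_nat (m choose k) * a (m - k) * egf_inverse a k) =
      a 0 * egf_inverse a m + (\<Sum>k<m. of_nat (m choose k) * a (m - k) * egf_inverse a k)"
    by simp
  also have "a 0 * egf_inverse a m = (if m = 0 then 1 else 0) -
      (\<Sum>k<m. of_nat (m choose k) * a (m - k) * egf_inverse a k)"
    using assms by (subst egf_inverse.simps) simp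
  finally show ?thesis by simp
qed

text \<open>The expression \<open>egf_inverse (\<lambda>k. F k s) m\<close> is the \<open>m\<close>-th derivative of \<open>1 / F 0\<close>:
  differentiating the recursion for index \<open>m\<close> and collecting terms by Pascal's rule gives the
  recursion for index \<open>m + 1\<close>. The same step shows that the derivative of order \<open>m + 1\<close>
  exists.\<close>

lemma has_vector_derivative_egf_inverse:
  fixes F :: "nat \<Rightarrow> real \<Rightarrow> complex"
  assumes F: "\<And>k. k < N \<Longrightarrow> (F k has_vector_derivative F (Suc k) t) (at t)"
    and nz: "F 0 t \<noteq> 0"
    and "m < N"
  shows "((\<lambda>s. egf_inverse (\<lambda>k. F k s) m) has_vector_derivative
    egf_inverse (\<lambda>k. F k t) (Suc m)) (at t)"
  using \<open>m < N\<close>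
proof (induction m rule: less_induct)
  case (less m)
  define G where "G k s = egf_inverse (\<lambda>k. F k s) k" for k s
  define \<delta> :: complex where "\<delta> = (if m = 0 then 1 else 0)"
  define S where "S s = (\<Sum>k<m. of_nat (m choose k) * (F (m - k) s * G k s))" for s
  define S' where "S' = (\<Sum>k<m. of_nat (m choose k) * (F (m - k) t * G (Suc k) t + F (Suc m - k) t * G k t))"
  have Gm: "G m s = (\<delta> - S s) / F 0 s" for s
    unfolding G_def S_def \<delta>_def by (subst egf_inverse.simps) (simp add: mult.assoc)
  have S: "(S has_vector_derivative S') (at t)"
    unfolding S_def S'_def
  proof (rule has_vector_derivative_sum, rule has_vector_derivative_mult_right,
      rule has_vector_derivative_mult)
    fix k assume "k \<in> {..<m}"
    then have k: "k < m" by simp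
    with less.prems have "m - k < N" by simp
    from F[OF this] k show "(F (m - k) has_vector_derivative F (Suc m - k) t) (at t)"
      by (simp add: Suc_diff_le)
    show "(G k has_vector_derivative G (Suc k) t) (at t)"
      using less.IH[OF k] k less.prems unfolding G_def by simp
  qed
  have F0: "(F 0 has_vector_derivative F 1 t) (at t)"
    using F[of 0] less.prems by simp
  have inv: "((\<lambda>s. inverse (F 0 s)) has_vector_derivative - F 1 t / (F 0 t)\<^sup>2) (at t)"
    using field_vector_diff_chain_at[OF F0 DERIV_inverse[OF nz]]
    by (simp add: o_def power2_eq_square field_simps)
  have "((\<lambda>s. (\<delta> - S s) * inverse (F 0 s)) has_vector_derivative
      (\<delta> - S t) * (- F 1 t / (F 0 t)\<^sup>2) + (0 - S') * inverse (F 0 t)) (at t)"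
    by (intro has_vector_derivative_mult has_vector_derivative_diff S inv has_vector_derivative_const)
  also have "(\<lambda>s. (\<delta> - S s) * inverse (F 0 s)) = G m"
    by (simp add: fun_eq_iff Gm field_simps)
  also have "(\<delta> - S t) * (- F 1 t / (F 0 t)\<^sup>2) + (0 - S') * inverse (F 0 t) =
      - (F 1 t * G m t + S') / F 0 t"
    using nz by (simp add: Gm field_simps power2_eq_square)
  also have "F 1 t * G m t + S' = (\<Sum>k<Suc m. of_nat (Suc m choose k) * (F (Suc m - k) t * G k t))"
  proof -
    let ?b = "\<lambda>k. F (Suc m - k) t * G k t"
    have ins: "{..m} = insert m {..<m}" "{..Suc m} = insert (Suc m) {..<Suc m}" by auto
    have "F 1 t * G m t + S' = (\<Sum>k<m. of_nat (m choose k) * ?b (Suc k)) +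
        (F 1 t * G m t + (\<Sum>k<m. of_nat (m choose k) * ?b k))"
      unfolding S'_def by (simp add: distrib_left sum.distrib)
    also have "F 1 t * G m t + (\<Sum>k<m. of_nat (m choose k) * ?b k) = (\<Sum>k\<le>m. of_nat (m choose k) * ?b k)"
      unfolding ins by simp
    also have "(\<Sum>k<m. of_nat (m choose k) * ?b (Suc k)) =
        (\<Sum>k\<le>m. of_nat (m choose k) * ?b (Suc k)) - ?b (Suc m)"
      unfolding ins by simp
    also have "\<dots> + (\<Sum>k\<le>m. of_nat (m choose k) * ?b k) =
        (\<Sum>k\<le>Suc m. of_nat (Suc m choose k) * ?b k) - ?b (Suc m)"
      unfolding sum_binomial_Suc[of m ?b] by simp
    also have "\<dots> = (\<Sum>k<Suc m. of_nat (Suc m choose k) * ?b k)"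
      unfolding ins(2) by simp
    finally show ?thesis .
  qed
  also have "- \<dots> / F 0 t = G (Suc m) t"
    unfolding G_def by (subst (2) egf_inverse.simps) (simp add: mult.assoc)
  finally show ?case unfolding G_def .
qed

section \<open>Constant-coefficient differential operators on polynomials\<close>

text \<open>The operator \<open>c(D)\<close> for the formal power series \<open>c(X) = \<Sum> c k X\<^sup>k\<close>, cut off at order
  \<open>n\<close>. On polynomials of degree below \<open>n\<close> the cut-off changes nothing.\<close>

definition deriv_series :: "nat \<Rightarrow> (nat \<Rightarrow> 'a::field_char_0) \<Rightarrow> 'a poly \<Rightarrow> 'a poly" where
  "deriv_series n c P = (\<Sum>k<n. Polynomial.smult (c k) ((pderiv ^^ k) P))"

lemma higher_pderiv_eq_0: "Polynomial.degree P < k \<Longrightarrow> (pderiv ^^ k) (P::'a::field_char_0 poly) = 0"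
  by (intro poly_eqI) (simp add: coeff_higher_pderiv coeff_eq_0)

lemma degree_deriv_series:
  assumes "Polynomial.degree P < n"
  shows "Polynomial.degree (deriv_series n c P) < n"
proof -
  have "Polynomial.degree (deriv_series n c P) \<le> Polynomial.degree P"
    unfolding deriv_series_def
    by (intro degree_sum_le order.trans[OF degree_smult_le]) (auto simp: degree_higher_pderiv)
  with assms show ?thesis by simp
qed

lemma deriv_series_smult: "deriv_series n c (Polynomial.smult a P) = Polynomial.smult a (deriv_series n c P)"
  by (simp add: deriv_series_def higher_pderiv_smult smult_sum2 mult.commute)

lemma deriv_series_sum: "deriv_series n c (\<Sum>j\<in>A. P j) = (\<Sum>j\<in>A. deriv_series n c (P j))"
  by (simp add: deriv_series_def higher_pderiv_sum smult_sum2 sum.swap[of _ A])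

text \<open>Composition of operators is the Cauchy product of their series, since the terms of
  total order \<open>n\<close> or more annihilate \<open>P\<close>.\<close>

lemma deriv_series_inverse:
  assumes conv: "\<And>m. m < n \<Longrightarrow> (\<Sum>k\<le>m. c k * d (m - k)) = (if m = 0 then 1 else 0)"
    and deg: "Polynomial.degree P < n"
  shows "deriv_series n c (deriv_series n d P) = P"
proof -
  let ?g = "\<lambda>k l. Polynomial.smult (c k * d l) ((pderiv ^^ (k + l)) P)"
  have "deriv_series n c (deriv_series n d P) = (\<Sum>k<n. \<Sum>l<n. ?g k l)"
    by (simp add: deriv_series_def higher_pderiv_sum higher_pderiv_smult smult_sum2 funpow_add)
  also have "\<dots> = (\<Sum>(k,l)\<in>{..<n} \<times> {..<n}. ?g k l)"
    by (simp add: sum.cartesian_product)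
  also have "\<dots> = (\<Sum>(k,l)\<in>{(k,l). k + l < n}. ?g k l)"
    using deg by (intro sum.mono_neutral_right) (auto simp: higher_pderiv_eq_0)
  also have "\<dots> = (\<Sum>m<n. \<Sum>k\<le>m. ?g k (m - k))"
    by (rule sum.triangle_reindex)
  also have "\<dots> = (\<Sum>m<n. Polynomial.smult (\<Sum>k\<le>m. c k * d (m - k)) ((pderiv ^^ m) P))"
    by (simp add: smult_sum)
  also have "\<dots> = (\<Sum>m<n. if m = 0 then P else 0)"
    by (intro sum.cong) (auto simp: conv)
  also have "\<dots> = P" using deg by simp
  finally show ?thesis .
qed

lemma higher_pderiv_pCons:
  "(pderiv ^^ Suc k) (pCons a (q::'a::field_char_0 poly)) =
    pCons 0 ((pderiv ^^ Suc k) q) + Polynomial.smult (of_nat (Suc k)) ((pderiv ^^ k) q)"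
proof (induction k)
  case 0
  then show ?case by (simp add: pderiv_pCons)
next
  case (Suc k)
  have "(pderiv ^^ Suc (Suc k)) (pCons a q) = pderiv ((pderiv ^^ Suc k) (pCons a q))" by simp
  also have "\<dots> = pCons 0 ((pderiv ^^ Suc (Suc k)) q) + (pderiv ^^ Suc k) q + Polynomial.smult (of_nat (Suc k)) ((pderiv ^^ Suc k) q)"
    unfolding Suc by (simp add: pderiv_add pderiv_pCons pderiv_smult)
  also have "\<dots> = pCons 0 ((pderiv ^^ Suc (Suc k)) q) + Polynomial.smult (of_nat (Suc (Suc k))) ((pderiv ^^ Suc k) q)"
    by (simp only: of_nat_Suc[of "Suc k"] smult_add_left smult_1_left add.assoc)
  finally show ?case .
qed

lemma poly_taylor:
  fixes P :: "'a::field_char_0 poly"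
  assumes "Polynomial.degree P < N"
  shows "poly P (z + x) = (\<Sum>k<N. x ^ k / fact k * poly ((pderiv ^^ k) P) z)"
  using assms
proof (induction P arbitrary: N)
  case 0
  then show ?case by simp
next
  case (pCons a q)
  obtain N' where N: "N = Suc N'" using pCons.prems by (cases N) auto
  have IH: "poly q (z + x) = (\<Sum>k<N'. x ^ k / fact k * poly ((pderiv ^^ k) q) z)"
  proof (cases "q = 0")
    case False
    with pCons.prems N have "Polynomial.degree q < N'" by simp
    then show ?thesis by (rule pCons.IH)
  qed simp
  have IH': "poly q (z + x) = poly q z + (\<Sum>k<N'. x ^ Suc k / fact (Suc k) * poly ((pderiv ^^ Suc k) q) z)"
  proof (cases "q = 0")
    case False
    with pCons.prems N have "Polynomial.degree q < Suc N'" by simp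
    then show ?thesis by (subst pCons.IH[of "Suc N'"]) (auto simp: sum.lessThan_Suc_shift simp del: sum.lessThan_Suc)
  qed (simp del: funpow.simps)
  have "(\<Sum>k<N. x ^ k / fact k * poly ((pderiv ^^ k) (pCons a q)) z) =
      poly (pCons a q) z + (\<Sum>k<N'. x ^ Suc k / fact (Suc k) * poly ((pderiv ^^ Suc k) (pCons a q)) z)"
    unfolding N by (simp add: sum.lessThan_Suc_shift del: sum.lessThan_Suc)
  also have "(\<Sum>k<N'. x ^ Suc k / fact (Suc k) * poly ((pderiv ^^ Suc k) (pCons a q)) z) =
      (\<Sum>k<N'. z * (x ^ Suc k / fact (Suc k) * poly ((pderiv ^^ Suc k) q) z) +
        x * (x ^ k / fact k * poly ((pderiv ^^ k) q) z))"
    unfolding higher_pderiv_pCons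
    by (intro sum.cong refl) (simp add: field_simps del: funpow.simps of_nat_Suc)
  also have "\<dots> = z * (poly q (z + x) - poly q z) + x * poly q (z + x)"
    unfolding sum.distrib sum_distrib_left[symmetric] IH[symmetric] using IH' by (simp del: funpow.simps)
  finally show ?case by (simp add: algebra_simps)
qed

section \<open>Spans of polynomials\<close>

lemma poly_eq_if_eq_on_reals:
  fixes P Q :: "complex poly"
  assumes "\<And>y::real. poly P (of_real y) = poly Q (of_real y)"
  shows "P = Q"
proof (rule ccontr)
  assume "P \<noteq> Q"
  then have "finite {x. poly (P - Q) x = 0}" by (intro poly_roots_finite) simp
  moreover have "range complex_of_real \<subseteq> {x. poly (P - Q) x = 0}" using assms by auto
  ultimately have "finite (range complex_of_real)" by (rule finite_subset[rotated])
  then have "finite (UNIV :: real set)" by (rule finite_imageD) (simp add: inj_on_def)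
  then show False by (simp add: infinite_UNIV_char_0)
qed

lemma lin_span_base: "j \<in> I \<Longrightarrow> finite I \<Longrightarrow> f j \<in> lin_span I f"
  unfolding lin_span_def by (auto intro!: exI[of _ "\<lambda>i. if i = j then 1 else 0"] simp: if_distrib[of "\<lambda>c. c * _"] cong: if_cong)

lemma lin_span_monomials:
  assumes "1 \<le> n"
  shows "lin_span {..<n} (\<lambda>j y. complex_of_real y ^ j) =
    {\<lambda>y. poly Q (complex_of_real y) | Q. Polynomial.degree Q < n}"
proof (intro subset_antisym subsetI)
  fix g assume "g \<in> lin_span {..<n} (\<lambda>j y. complex_of_real y ^ j)"
  then obtain c where g: "\<And>y. g y = (\<Sum>j<n. c j * complex_of_real y ^ j)"
    unfolding lin_span_def by auto
  have "Polynomial.degree (\<Sum>j<n. Polynomial.monom (c j) j) < n"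
    using assms by (intro degree_sum_less) (auto intro: le_less_trans[OF degree_monom_le])
  moreover have "g = (\<lambda>y. poly (\<Sum>j<n. Polynomial.monom (c j) j) (complex_of_real y))"
    by (simp add: fun_eq_iff g poly_sum poly_monom)
  ultimately show "g \<in> {\<lambda>y. poly Q (complex_of_real y) | Q. Polynomial.degree Q < n}" by blast
next
  fix g assume "g \<in> {\<lambda>y. poly Q (complex_of_real y) | Q. Polynomial.degree Q < n}"
  then obtain Q where Q: "Polynomial.degree Q < n" and g: "g = (\<lambda>y. poly Q (complex_of_real y))"
    by blast
  have "g y = (\<Sum>j<n. Polynomial.coeff Q j * complex_of_real y ^ j)" for y
    unfolding g poly_altdef using Q
    by (intro sum.mono_neutral_left) (auto simp: coeff_eq_0)
  then show "g \<in> lin_span {..<n} (\<lambda>j y. complex_of_real y ^ j)"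
    unfolding lin_span_def by blast
qed

text \<open>An invertible operator on the polynomials of degree below \<open>n\<close> maps a spanning family
  to a spanning family.\<close>

lemma lin_span_deriv_series:
  fixes P :: "nat \<Rightarrow> complex poly"
  assumes "1 \<le> n"
    and span: "lin_span {..<n} (\<lambda>j y. poly (P j) (complex_of_real y)) = lin_span {..<n} (\<lambda>j y. complex_of_real y ^ j)"
    and P: "\<And>j. j < n \<Longrightarrow> Polynomial.degree (P j) < n"
    and inv: "\<And>Q. Polynomial.degree Q < n \<Longrightarrow> deriv_series n c (deriv_series n d Q) = Q"
  shows "lin_span {..<n} (\<lambda>j y. poly (deriv_series n c (P j)) (complex_of_real y)) =
    lin_span {..<n} (\<lambda>j y. complex_of_real y ^ j)"
  unfolding lin_span_monomials[OF \<open>1 \<le> n\<close>]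
proof (intro subset_antisym subsetI)
  fix g assume "g \<in> lin_span {..<n} (\<lambda>j y. poly (deriv_series n c (P j)) (complex_of_real y))"
  then obtain a where g: "\<And>y. g y = (\<Sum>j<n. a j * poly (deriv_series n c (P j)) (complex_of_real y))"
    unfolding lin_span_def by auto
  have "Polynomial.degree (\<Sum>j<n. Polynomial.smult (a j) (deriv_series n c (P j))) < n"
    using assms(1) by (intro degree_sum_less) (auto intro: le_less_trans[OF degree_smult_le] degree_deriv_series P)
  moreover have "g = (\<lambda>y. poly (\<Sum>j<n. Polynomial.smult (a j) (deriv_series n c (P j))) (complex_of_real y))"
    by (simp add: fun_eq_iff g poly_sum)
  ultimately show "g \<in> {\<lambda>y. poly Q (complex_of_real y) | Q. Polynomial.degree Q < n}" by blast
next
  fix g assume "g \<in> {\<lambda>y. poly Q (complex_of_real y) | Q. Polynomial.degree Q < n}"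
  then obtain Q where Q: "Polynomial.degree Q < n" and g: "g = (\<lambda>y. poly Q (complex_of_real y))"
    by blast
  have "(\<lambda>y. poly (deriv_series n d Q) (complex_of_real y)) \<in> lin_span {..<n} (\<lambda>j y. poly (P j) (complex_of_real y))"
    unfolding span lin_span_monomials[OF \<open>1 \<le> n\<close>] using degree_deriv_series[OF Q] by blast
  then obtain a where "\<And>y::real. poly (deriv_series n d Q) (complex_of_real y) = (\<Sum>j<n. a j * poly (P j) (complex_of_real y))"
    unfolding lin_span_def by auto
  then have "deriv_series n d Q = (\<Sum>j<n. Polynomial.smult (a j) (P j))"
    by (intro poly_eq_if_eq_on_reals) (simp add: poly_sum)
  then have "Q = (\<Sum>j<n. Polynomial.smult (a j) (deriv_series n c (P j)))"
    using inv[OF Q] by (simp add: deriv_series_sum deriv_series_smult)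
  then have "g y = (\<Sum>j<n. a j * poly (deriv_series n c (P j)) (complex_of_real y))" for y
    by (simp add: g poly_sum)
  then show "g \<in> lin_span {..<n} (\<lambda>j y. poly (deriv_series n c (P j)) (complex_of_real y))"
    unfolding lin_span_def by blast
qed

section \<open>Moments\<close>

text \<open>The two integrands differ only by a sign and, if \<open>k = 0\<close>, at the point \<open>0\<close>, where \<open>0
  powr 0 = 0\<close> but \<open>0 ^ 0 = 1\<close>.\<close>

lemma integrable_power_of_abs_powr:
  fixes f :: "real \<Rightarrow> 'b::{banach, second_countable_topology}"
  assumes f: "integrable lborel f"
    and powr: "integrable lborel (\<lambda>x. (\<bar>x\<bar> powr real k) *\<^sub>R f x)"
  shows "integrable lborel (\<lambda>x. x ^ k *\<^sub>R f x)"
proof (rule Bochner_Integration.integrable_bound[OF powr])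
  have [measurable]: "f \<in> borel_measurable borel" using f by auto
  show "(\<lambda>x. x ^ k *\<^sub>R f x) \<in> borel_measurable lborel" by measurable
  show "AE x in lborel. norm (x ^ k *\<^sub>R f x) \<le> norm ((\<bar>x\<bar> powr real k) *\<^sub>R f x)"
    using AE_lborel_singleton[of "0::real"]
    by eventually_elim (simp add: powr_realpow power_abs)
qed

lemma L1_moments_power:
  fixes f :: "real \<Rightarrow> 'b::{banach, second_countable_topology}"
  assumes "f \<in> L1_moments n" "k < n"
  shows "integrable lborel (\<lambda>x. x ^ k *\<^sub>R f x)"
proof (rule integrable_power_of_abs_powr)
  show "integrable lborel f" using assms(1) by (simp add: L1_moments_def)
  have "real k + 1 \<in> {1..real n}" using assms(2) by auto
  with assms(1) have "integrable lborel (\<lambda>x. (\<bar>x\<bar> powr (real k + 1 - 1)) *\<^sub>R f x)"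
    unfolding L1_moments_def by blast
  then show "integrable lborel (\<lambda>x. (\<bar>x\<bar> powr real k) *\<^sub>R f x)" by simp
qed

lemma L1_F_imp_L1_moments:
  assumes "f \<in> L1_F n" "1 \<le> n"
  shows "f \<in> L1_moments n"
  using assms unfolding L1_F_def L1_moments_def by fastforce

lemma integrable_poly_mult:
  fixes w :: "real \<Rightarrow> complex"
  assumes w: "\<And>k. k < n \<Longrightarrow> integrable lborel (\<lambda>x. x ^ k *\<^sub>R w x)"
    and P: "Polynomial.degree P < n"
  shows "integrable lborel (\<lambda>x. poly P (of_real x) * w x)"
proof -
  have "(\<lambda>x. poly P (complex_of_real x) * w x) =
      (\<lambda>x. \<Sum>k\<le>Polynomial.degree P. Polynomial.coeff P k * (x ^ k *\<^sub>R w x))"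
    by (simp add: poly_altdef sum_distrib_right scaleR_conv_of_real mult.assoc)
  moreover have "integrable lborel (\<lambda>x. \<Sum>k\<le>Polynomial.degree P. Polynomial.coeff P k * (x ^ k *\<^sub>R w x))"
    by (intro Bochner_Integration.integrable_sum integrable_mult_right w) (use P in auto)
  ultimately show ?thesis by (simp only:)
qed

section \<open>The Fourier transform and its derivatives\<close>

lemma has_vector_derivative_iff_Lim:
  "(f has_vector_derivative D) (at t) \<longleftrightarrow> ((\<lambda>s. (f s - f t) /\<^sub>R (s - t)) \<longlongrightarrow> D) (at t)"
proof -
  have "(f has_vector_derivative D) (at t) \<longleftrightarrow>
      ((\<lambda>s. norm (f s - f t - (s - t) *\<^sub>R D) / norm (s - t)) \<longlongrightarrow> 0) (at t)"
    unfolding has_vector_derivative_def has_derivative_iff_norm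
    by (simp add: bounded_linear_scaleR_left)
  also have "\<dots> \<longleftrightarrow> ((\<lambda>s. norm ((f s - f t) /\<^sub>R (s - t) - D)) \<longlongrightarrow> 0) (at t)"
  proof (rule Lim_cong_within[OF refl refl refl])
    fix s :: real assume "s \<noteq> t"
    then have "(f s - f t) /\<^sub>R (s - t) - D = (f s - f t - (s - t) *\<^sub>R D) /\<^sub>R (s - t)"
      by (simp add: scaleR_diff_right)
    then show "norm (f s - f t - (s - t) *\<^sub>R D) / norm (s - t) = norm ((f s - f t) /\<^sub>R (s - t) - D)"
      by (simp add: divide_inverse mult.commute)
  qed
  also have "\<dots> \<longleftrightarrow> ((\<lambda>s. (f s - f t) /\<^sub>R (s - t)) \<longlongrightarrow> D) (at t)"
    by (simp only: tendsto_norm_zero_iff LIM_zero_iff)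
  finally show ?thesis .
qed

text \<open>Dominated convergence for the difference quotients: \<open>|exp (\<i> x s) - exp (\<i> x t)| \<le> |x|
  |s - t|\<close>.\<close>

lemma has_vector_derivative_fourier_integral:
  fixes h :: "real \<Rightarrow> complex"
  assumes h: "integrable lborel h" and xh: "integrable lborel (\<lambda>x. x *\<^sub>R h x)"
  shows "((\<lambda>s. LINT x|lborel. h x * exp (\<i> * of_real (x * s))) has_vector_derivative
    (LINT x|lborel. \<i> * of_real x * h x * exp (\<i> * of_real (x * t)))) (at t)"
proof -
  define e where "e x s = exp (\<i> * complex_of_real (x * s))" for x s :: real
  have [measurable]: "h \<in> borel_measurable borel" using h by auto
  have norm_e [simp]: "cmod (e x s) = 1" for x s
    unfolding e_def by simp
  have int: "integrable lborel (\<lambda>x. h x * e x s)" for s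
    by (rule Bochner_Integration.integrable_bound[OF h]) (auto simp: norm_mult e_def[symmetric], simp add: e_def)
  have e_diff: "cmod (e x s - e x t) \<le> \<bar>x\<bar> * \<bar>s - t\<bar>" for x s
  proof -
    have "e x s - e x t = e x t * (iexp (x * (s - t)) - 1)"
      unfolding e_def by (simp add: algebra_simps flip: exp_add)
    then have "cmod (e x s - e x t) = cmod (iexp (x * (s - t)) - 1)"
      by (simp add: norm_mult)
    also have "\<dots> \<le> \<bar>x\<bar> * \<bar>s - t\<bar>"
      using iexp_approx1[of "x * (s - t)" 0] by (simp add: abs_mult)
    finally show ?thesis .
  qed
  have e_deriv: "(e x has_vector_derivative \<i> * of_real x * e x t) (at t)" for x
  proof -
    have "((\<lambda>s. exp (\<i> * of_real x * s)) has_field_derivative \<i> * of_real x * exp (\<i> * of_real x * of_real t))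
        (at (complex_of_real t))"
      by (auto intro!: derivative_eq_intros)
    from has_vector_derivative_real_field[OF this, of UNIV] show ?thesis
      unfolding e_def by (simp add: mult.assoc)
  qed
  have "((\<lambda>s. ((LINT x|lborel. h x * e x s) - (LINT x|lborel. h x * e x t)) /\<^sub>R (s - t))
      \<longlongrightarrow> (LINT x|lborel. h x * (\<i> * of_real x * e x t))) (at t)"
    unfolding tendsto_at_iff_sequentially
  proof (intro allI impI)
    fix X :: "nat \<Rightarrow> real" assume X: "\<forall>i. X i \<in> UNIV - {t}" "X \<longlonglongrightarrow> t"
    have "(\<lambda>i. LINT x|lborel. h x * ((e x (X i) - e x t) /\<^sub>R (X i - t)))
        \<longlonglongrightarrow> (LINT x|lborel. h x * (\<i> * of_real x * e x t))"
    proof (rule integral_dominated_convergence[where w = "\<lambda>x. norm (x *\<^sub>R h x)"])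
      show "integrable lborel (\<lambda>x. norm (x *\<^sub>R h x))" using xh by (rule integrable_norm)
      show "AE x in lborel. (\<lambda>i. h x * ((e x (X i) - e x t) /\<^sub>R (X i - t)))
          \<longlonglongrightarrow> h x * (\<i> * of_real x * e x t)"
      proof (intro AE_I2 tendsto_mult tendsto_const)
        fix x
        have "((\<lambda>s. (e x s - e x t) /\<^sub>R (s - t)) \<longlongrightarrow> \<i> * of_real x * e x t) (at t)"
          by (rule e_deriv[of x, unfolded has_vector_derivative_iff_Lim])
        then show "(\<lambda>i. (e x (X i) - e x t) /\<^sub>R (X i - t)) \<longlonglongrightarrow> \<i> * of_real x * e x t"
          unfolding tendsto_at_iff_sequentially using X by (auto simp: o_def)
      qed
      show "AE x in lborel. cmod (h x * ((e x (X i) - e x t) /\<^sub>R (X i - t))) \<le> norm (x *\<^sub>R h x)" for i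
      proof (rule AE_I2)
        fix x
        have "X i - t \<noteq> 0" using X(1) by auto
        then have "cmod ((e x (X i) - e x t) /\<^sub>R (X i - t)) \<le> \<bar>x\<bar>"
          using e_diff[of x "X i"] by (simp add: pos_divide_le_eq divide_inverse_commute[symmetric])
        from mult_left_mono[OF this, of "cmod (h x)"]
        show "cmod (h x * ((e x (X i) - e x t) /\<^sub>R (X i - t))) \<le> norm (x *\<^sub>R h x)"
          unfolding norm_mult norm_scaleR by (simp add: mult_ac)
      qed
    qed (simp_all add: e_def)
    moreover have "(LINT x|lborel. h x * ((e x (X i) - e x t) /\<^sub>R (X i - t))) =
        ((LINT x|lborel. h x * e x (X i)) - (LINT x|lborel. h x * e x t)) /\<^sub>R (X i - t)" for i
    proof -
      have "(\<lambda>x. h x * ((e x (X i) - e x t) /\<^sub>R (X i - t))) =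
          (\<lambda>x. (h x * e x (X i) - h x * e x t) /\<^sub>R (X i - t))"
        by (simp add: right_diff_distrib)
      then show ?thesis
        by (simp only: integral_scaleR_right Bochner_Integration.integral_diff[OF int int])
    qed
    ultimately show "((\<lambda>s. ((LINT x|lborel. h x * e x s) - (LINT x|lborel. h x * e x t)) /\<^sub>R (s - t)) \<circ> X)
        \<longlonglongrightarrow> (LINT x|lborel. h x * (\<i> * of_real x * e x t))"
      unfolding o_def by (simp only:)
  qed
  then show ?thesis
    unfolding e_def[symmetric] has_vector_derivative_iff_Lim by (simp only: mult.assoc mult.left_commute)
qed

lemma fourier_at_0: "fourier f 0 = complex_of_real (LINT x|lborel. f x)"
  by (simp add: fourier_def)

text \<open>A nonnegative \<open>f\<close> with vanishing integral is almost everywhere \<open>0\<close>. Then so is the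
  first row of the weight determinant, and the normalization constant is \<open>fact n / 0 = 0\<close>.\<close>

lemma fourier_0_nonzero:
  assumes f: "integrable lborel f" "\<And>x. 0 \<le> f x"
    and n: "1 \<le> n" and norm: "norm_const n (polya_weights f) \<noteq> 0"
  shows "fourier f 0 \<noteq> 0"
proof
  assume "fourier f 0 = 0"
  then have "(LINT x|lborel. f x) = 0" by (simp add: fourier_at_0)
  then have f0: "AE x in lborel. f x = 0"
    using integral_nonneg_eq_0_iff_AE[of lborel f] f by simp
  have [measurable]: "f \<in> borel_measurable borel" using f by auto
  let ?M = "\<Pi>\<^sub>M i\<in>{1..n}. lborel :: real measure"
  interpret product_sigma_finite "\<lambda>_::nat. lborel :: real measure" ..
  have N: "{x. f x \<noteq> 0} \<in> sets lborel" by simp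
  have N0: "emeasure lborel {x. f x \<noteq> 0} = 0"
    using f0 N by (subst (asm) AE_iff_measurable[of "{x. f x \<noteq> 0}"]) auto
  have "AE a in ?M. f (a i) = 0" if i: "i \<in> {1..n}" for i
  proof -
    define B where "B = (\<Pi>\<^sub>E j\<in>{1..n}. if j = i then {x. f x \<noteq> 0} else UNIV :: real set)"
    have "emeasure ?M B = 0"
      unfolding B_def using N N0 i by (subst emeasure_PiM) (auto intro!: prod_zero bexI[of _ i])
    moreover have "B \<in> sets ?M"
      unfolding B_def using N by (intro sets_PiM_I_finite) auto
    ultimately have "B \<in> null_sets ?M" by auto
    then show ?thesis
      by (rule AE_I') (auto simp: B_def space_PiM PiE_iff extensional_def)
  qed
  then have "AE a in ?M. \<forall>i\<in>{1..n}. f (a i) = 0"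
    by (intro AE_finite_allI) auto
  then have "AE a in ?M. complex_of_real (vandermonde n a) * weight_det n (polya_weights f) a = 0"
  proof eventually_elim
    case (elim a)
    have "weight_det n (polya_weights f) a = 0"
      unfolding weight_det_def using n elim
      by (subst laplace_expansion_row[of _ n 0]) (auto simp: polya_weights_def intro!: sum.neutral)
    then show ?case by simp
  qed
  then have "(LINT a|?M. complex_of_real (vandermonde n a) * weight_det n (polya_weights f) a) = 0"
    by (rule integral_eq_zero_AE)
  then have "norm_const n (polya_weights f) = 0"
    unfolding norm_const_def by simp
  with norm show False by contradiction
qed

section \<open>The integral over the differential operator\<close>

text \<open>The Gamma integral \<open>\<integral> r\<^sup>N\<^sup>-\<^sup>l exp (-r) dr = (N - l)!\<close> turns the binomial coefficients
  of \<open>(r + X)\<^sup>N / N!\<close> into \<open>1 / l!\<close>, that is, into the exponential series of \<open>X\<close>.\<close>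

lemma integral_exp_power_Ici:
  fixes e :: "nat \<Rightarrow> complex"
  shows "(LBINT r:{0..}. exp (- r) *\<^sub>R
      ((\<Sum>l\<le>N. of_nat (N choose l) * of_real r ^ (N - l) * e l) / fact N)) = (\<Sum>l\<le>N. e l / fact l)"
proof -
  let ?g = "\<lambda>l r::real. r ^ (N - l) * exp (- r) * indicator {0..} r"
  have "(LBINT r:{0..}. exp (- r) *\<^sub>R
      ((\<Sum>l\<le>N. of_nat (N choose l) * of_real r ^ (N - l) * e l) / fact N)) =
    (LINT r|lborel. (\<Sum>l\<le>N. complex_of_real (?g l r) * (of_nat (N choose l) * e l / fact N)))"
    unfolding set_lebesgue_integral_def
  proof (intro Bochner_Integration.integral_cong refl)
    fix r :: real
    show "indicator {0..} r *\<^sub>R (exp (- r) *\<^sub>R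
        ((\<Sum>l\<le>N. of_nat (N choose l) * of_real r ^ (N - l) * e l) / fact N)) =
      (\<Sum>l\<le>N. complex_of_real (?g l r) * (of_nat (N choose l) * e l / fact N))"
      unfolding scaleR_conv_of_real sum_divide_distrib sum_distrib_left of_real_mult of_real_power
      by (intro sum.cong refl) (simp only: mult_ac times_divide_eq_left times_divide_eq_right)
  qed
  also have "\<dots> = (\<Sum>l\<le>N. fact (N - l) * (of_nat (N choose l) * e l / fact N))"
  proof (rule has_bochner_integral_integral_eq, rule has_bochner_integral_sum, rule has_bochner_integral_mult_left)
    fix l
    show "has_bochner_integral lborel (\<lambda>r. complex_of_real (?g l r)) (fact (N - l))"
      using has_bochner_integral_of_real[OF has_bochner_integral_I0i_power_exp_m'[of "N - l"]] by simp
  qed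
  also have "\<dots> = (\<Sum>l\<le>N. e l / fact l)"
    by (intro sum.cong refl) (simp add: binomial_fact del: of_nat_fact)
  finally show ?thesis .
qed

text \<open>The binomial theorem for \<open>(r - \<i> \<partial>\<^sub>t \<partial>\<^sub>y)\<^sup>m\<close>. The formula is needed at all \<open>t\<close> with \<open>F
  0 t \<noteq> 0\<close>, not only at \<open>0\<close>, because the induction step differentiates it in \<open>t\<close>.\<close>

lemma diff_op_funpow:
  fixes F :: "nat \<Rightarrow> real \<Rightarrow> complex"
  assumes F: "\<And>k t. k < N \<Longrightarrow> (F k has_vector_derivative F (Suc k) t) (at t)"
    and "m \<le> N" and "F 0 t \<noteq> 0"
  shows "(diff_op r ^^ m) (\<lambda>s z. poly P (of_real z) / F 0 s) t y =
    (\<Sum>l\<le>m. of_nat (m choose l) * (of_real r ^ (m - l) *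
       ((-\<i>) ^ l * egf_inverse (\<lambda>k. F k t) l * poly ((pderiv ^^ l) P) (of_real y))))"
  using assms(2,3)
proof (induction m arbitrary: t y)
  case 0
  then show ?case by (simp add: egf_inverse.simps[of _ 0])
next
  case (Suc m)
  define G where "G l s = egf_inverse (\<lambda>k. F k s) l" for l s
  define D where "D l z = poly ((pderiv ^^ l) P) (complex_of_real z)" for l and z :: real
  define g where "g = (diff_op r ^^ m) (\<lambda>s z. poly P (of_real z) / F 0 s)"
  have g: "g s z = (\<Sum>l\<le>m. of_nat (m choose l) * (of_real r ^ (m - l) * ((-\<i>) ^ l * G l s * D l z)))"
    if "F 0 s \<noteq> 0" for s z
    unfolding g_def G_def D_def using Suc.IH[OF _ that] Suc.prems(1) by simp
  have "continuous_on UNIV (F 0)"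
    using F[of 0] Suc.prems(1)
    by (auto intro!: continuous_at_imp_continuous_on has_vector_derivative_continuous)
  then have U: "open {s. F 0 s \<noteq> 0}"
    by (intro open_Collect_neq) auto
  have D: "(D l has_vector_derivative D (Suc l) z) (at z)" for l z
    unfolding D_def
    using has_vector_derivative_real_field[OF poly_DERIV, of "(pderiv ^^ l) P" z UNIV] by simp
  have G: "(G l has_vector_derivative G (Suc l) t) (at t)" if "l \<le> m" for l
    unfolding G_def using F Suc.prems that by (intro has_vector_derivative_egf_inverse[of N]) auto
  have dz: "vector_derivative (\<lambda>z. g s z) (at y) =
      (\<Sum>l\<le>m. of_nat (m choose l) * (of_real r ^ (m - l) * ((-\<i>) ^ l * G l s * D (Suc l) y)))"
    if "F 0 s \<noteq> 0" for s
    unfolding g[OF that]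
    by (intro vector_derivative_at has_vector_derivative_sum has_vector_derivative_mult_right D)
  have "((\<lambda>s. \<Sum>l\<le>m. of_nat (m choose l) * (of_real r ^ (m - l) * ((-\<i>) ^ l * G l s * D (Suc l) y)))
      has_vector_derivative (\<Sum>l\<le>m. of_nat (m choose l) *
        (of_real r ^ (m - l) * ((-\<i>) ^ l * G (Suc l) t * D (Suc l) y)))) (at t)"
    by (intro has_vector_derivative_sum has_vector_derivative_mult_right has_vector_derivative_mult_left G) simp
  then have "((\<lambda>s. vector_derivative (\<lambda>z. g s z) (at y)) has_vector_derivative
      (\<Sum>l\<le>m. of_nat (m choose l) * (of_real r ^ (m - l) * ((-\<i>) ^ l * G (Suc l) t * D (Suc l) y)))) (at t)"
    by (rule has_vector_derivative_transform_within_open[OF _ U]) (use Suc.prems(2) dz in auto)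
  then have dt: "vector_derivative (\<lambda>s. vector_derivative (\<lambda>z. g s z) (at y)) (at t) =
      (\<Sum>l\<le>m. of_nat (m choose l) * (of_real r ^ (m - l) * ((-\<i>) ^ l * G (Suc l) t * D (Suc l) y)))"
    by (rule vector_derivative_at)
  let ?b = "\<lambda>l. of_real r ^ (Suc m - l) * ((-\<i>) ^ l * G l t * D l y)"
  have "(diff_op r ^^ Suc m) (\<lambda>s z. poly P (of_real z) / F 0 s) t y = diff_op r g t y"
    by (simp add: g_def)
  also have "\<dots> = (\<Sum>l\<le>m. of_nat (m choose l) * ?b l) + (\<Sum>l\<le>m. of_nat (m choose l) * ?b (Suc l))"
    unfolding diff_op_def dt g[OF Suc.prems(2)] sum_distrib_left diff_conv_add_uminus sum_negf[symmetric]
    by (intro arg_cong2[where f = "(+)"] sum.cong refl) (auto simp: Suc_diff_le)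
  also have "\<dots> = (\<Sum>l\<le>Suc m. of_nat (Suc m choose l) * ?b l)"
    by (rule sum_binomial_Suc[symmetric])
  finally show ?case unfolding G_def D_def .
qed

text \<open>The integral formula for \<open>p\<^sub>j\<close> is the operator \<open>(1 / F)(-\<i> D)\<close>, where \<open>F = F 0\<close> and \<open>1
  / F\<close> is read as its Taylor series at \<open>0\<close>, cut off at order \<open>n\<close>.\<close>

lemma integral_exp_diff_op:
  fixes F :: "nat \<Rightarrow> real \<Rightarrow> complex"
  assumes F: "\<And>k t. k < n - 1 \<Longrightarrow> (F k has_vector_derivative F (Suc k) t) (at t)"
    and "F 0 0 \<noteq> 0" and "1 \<le> n"
  shows "(LBINT r:{0..}. exp (- r) *\<^sub>R
      ((diff_op r ^^ (n - 1)) (\<lambda>s z. poly P (of_real z) / F 0 s) 0 y / fact (n - 1))) =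
    poly (deriv_series n (\<lambda>l. (-\<i>) ^ l * egf_inverse (\<lambda>k. F k 0) l / fact l) P) (of_real y)"
proof -
  have "{..n - 1} = {..<n}" using assms(3) by auto
  moreover have "(diff_op r ^^ (n - 1)) (\<lambda>s z. poly P (of_real z) / F 0 s) 0 y =
      (\<Sum>l\<le>n - 1. of_nat ((n - 1) choose l) * (of_real r ^ (n - 1 - l) *
       ((-\<i>) ^ l * egf_inverse (\<lambda>k. F k 0) l * poly ((pderiv ^^ l) P) (of_real y))))" for r
    by (rule diff_op_funpow[OF _ order.refl]) (use F assms(2) in auto)
  ultimately show ?thesis
    unfolding deriv_series_def
    using integral_exp_power_Ici[of "n - 1"
      "\<lambda>l. (-\<i>) ^ l * egf_inverse (\<lambda>k. F k 0) l * poly ((pderiv ^^ l) P) (of_real y)"]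
    by (simp add: mult.assoc poly_sum)
qed

section \<open>Convolutions\<close>

text \<open>Integrating a polynomial against \<open>f \<star> w\<close> amounts to integrating its average \<open>z \<mapsto> \<integral> P
  (x + z) f x dx\<close> against \<open>w\<close>, and Taylor expansion in \<open>x\<close> writes the average as \<open>d(D) P\<close>
  whose coefficients are the moments of \<open>f\<close> divided by factorials. The same expansion bounds
  the integrand for Fubini by products of moments of \<open>f\<close> and \<open>w\<close>.\<close>

lemma has_bochner_integral_poly_conv:
  fixes f w :: "real \<Rightarrow> complex"
  assumes f: "\<And>k. k < n \<Longrightarrow> integrable lborel (\<lambda>x. x ^ k *\<^sub>R f x)"
    and w: "\<And>k. k < n \<Longrightarrow> integrable lborel (\<lambda>x. x ^ k *\<^sub>R w x)"
    and P: "Polynomial.degree P < n"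
  shows "has_bochner_integral lborel (\<lambda>y. poly P (of_real y) * (LINT x|lborel. f x * w (y - x)))
    (LINT z|lborel. poly (deriv_series n (\<lambda>k. (LINT x|lborel. x ^ k *\<^sub>R f x) / fact k) P) (of_real z) * w z)"
proof -
  have "integrable lborel f" "integrable lborel w"
    using f[of 0] w[of 0] P by auto
  then have [measurable]: "f \<in> borel_measurable borel" "w \<in> borel_measurable borel"
    by auto
  have [measurable]: "(\<lambda>x::real. poly Q (complex_of_real x)) \<in> borel_measurable borel" for Q
    by (intro borel_measurable_continuous_onI continuous_intros)
  define D where "D k z = poly ((pderiv ^^ k) P) (complex_of_real z)" for k and z :: real
  have D_int: "integrable lborel (\<lambda>z. D k z * w z)" for k
    unfolding D_def by (rule integrable_poly_mult[OF w]) (use P in \<open>auto simp: degree_higher_pderiv\<close>)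
  have taylor: "poly P (of_real (x + z)) = (\<Sum>k<n. of_real (x ^ k / fact k) * D k z)" for x z
    using poly_taylor[OF P, of "of_real z" "of_real x"] by (simp add: D_def add.commute)
  \<comment> \<open>After the shift \<open>y = x + z\<close> the integrand becomes a finite sum of products of a function of \<open>x\<close> and a function of \<open>z\<close>.\<close>
  define h where "h x y = f x * (poly P (of_real y) * w (y - x))" for x y
  have h_shift: "h x (x + 1 * z) = (\<Sum>k<n. (x ^ k *\<^sub>R f x) * (D k z * w z) / fact k)" for x z
    unfolding h_def mult_1 taylor
    by (simp add: sum_distrib_left sum_distrib_right scaleR_conv_of_real mult_ac)
  have int_shift: "integrable lborel (\<lambda>z. h x (x + 1 * z))" for x
    unfolding h_shift by (intro Bochner_Integration.integrable_sum integrable_divide integrable_mult_right D_int)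
  then have int_y: "integrable lborel (h x)" for x
    using lborel_integrable_real_affine_iff[of 1 "h x" x] by simp
  have h_y: "(LINT y|lborel. h x y) = (\<Sum>k<n. (x ^ k *\<^sub>R f x) * (LINT z|lborel. D k z * w z) / fact k)" for x
  proof -
    have "(LINT y|lborel. h x y) = (LINT z|lborel. h x (x + 1 * z))"
      using lborel_integral_real_affine[of 1 "h x" x] by simp
    also have "\<dots> = (\<Sum>k<n. (x ^ k *\<^sub>R f x) * (LINT z|lborel. D k z * w z) / fact k)"
      unfolding h_shift
      by (subst Bochner_Integration.integral_sum)
        (auto intro!: integrable_divide integrable_mult_right D_int)
    finally show ?thesis .
  qed
  have norm_y: "(LINT y|lborel. norm (h x y)) \<le>
      (\<Sum>k<n. norm (x ^ k *\<^sub>R f x) * (LINT z|lborel. norm (D k z * w z)) / fact k)" for x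
  proof -
    have "(LINT y|lborel. norm (h x y)) = (LINT z|lborel. norm (h x (x + 1 * z)))"
      using lborel_integral_real_affine[of 1 "\<lambda>y. norm (h x y)" x] by simp
    also have "\<dots> \<le> (LINT z|lborel. (\<Sum>k<n. norm (x ^ k *\<^sub>R f x) * norm (D k z * w z) / fact k))"
    proof (rule integral_mono)
      show "integrable lborel (\<lambda>z. norm (h x (x + 1 * z)))"
        by (intro integrable_norm int_shift)
      show "integrable lborel (\<lambda>z. \<Sum>k<n. norm (x ^ k *\<^sub>R f x) * norm (D k z * w z) / fact k)"
        by (intro Bochner_Integration.integrable_sum integrable_divide integrable_mult_right integrable_norm D_int)
      show "norm (h x (x + 1 * z)) \<le> (\<Sum>k<n. norm (x ^ k *\<^sub>R f x) * norm (D k z * w z) / fact k)" for z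
        unfolding h_shift by (rule order.trans[OF norm_sum]) (simp add: norm_mult norm_divide mult.assoc)
    qed
    also have "\<dots> = (\<Sum>k<n. norm (x ^ k *\<^sub>R f x) * (LINT z|lborel. norm (D k z * w z)) / fact k)"
      by (subst Bochner_Integration.integral_sum)
        (auto intro!: integrable_divide integrable_mult_right integrable_norm D_int simp del: norm_scaleR norm_mult)
    finally show ?thesis .
  qed
  have h_int: "integrable (lborel \<Otimes>\<^sub>M lborel) (\<lambda>(x, y). h x y)"
  proof (rule lborel_pair.Fubini_integrable)
    show meas [measurable]: "(\<lambda>(x, y). h x y) \<in> borel_measurable (lborel \<Otimes>\<^sub>M lborel)"
      unfolding h_def by measurable
    show "AE x in lborel. integrable lborel (\<lambda>y. case (x, y) of (x, y) \<Rightarrow> h x y)"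
      using int_y by simp
    have "integrable lborel (\<lambda>x. \<Sum>k<n. norm (x ^ k *\<^sub>R f x) * (LINT z|lborel. norm (D k z * w z)) / fact k)"
      by (intro Bochner_Integration.integrable_sum integrable_divide integrable_mult_left integrable_norm f) auto
    then show "integrable lborel (\<lambda>x. LINT y|lborel. norm (case (x, y) of (x, y) \<Rightarrow> h x y))"
    proof (rule Bochner_Integration.integrable_bound)
      show "(\<lambda>x. LINT y|lborel. norm (case (x, y) of (x, y) \<Rightarrow> h x y)) \<in> borel_measurable lborel"
        by measurable
      show "AE x in lborel. norm (LINT y|lborel. norm (case (x, y) of (x, y) \<Rightarrow> h x y)) \<le>
          norm (\<Sum>k<n. norm (x ^ k *\<^sub>R f x) * (LINT z|lborel. norm (D k z * w z)) / fact k)"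
      proof (rule AE_I2)
        fix x
        have "0 \<le> (LINT y|lborel. norm (h x y))" by simp
        with norm_y[of x] show "norm (LINT y|lborel. norm (case (x, y) of (x, y) \<Rightarrow> h x y)) \<le>
          norm (\<Sum>k<n. norm (x ^ k *\<^sub>R f x) * (LINT z|lborel. norm (D k z * w z)) / fact k)"
          unfolding prod.case real_norm_def by linarith
      qed
    qed
  qed
  have x_int: "(LINT x|lborel. h x y) = poly P (of_real y) * (LINT x|lborel. f x * w (y - x))" for y
  proof -
    have "(\<lambda>x. h x y) = (\<lambda>x. poly P (of_real y) * (f x * w (y - x)))"
      by (simp add: h_def mult_ac)
    then show ?thesis by simp
  qed
  have "(LINT y|lborel. LINT x|lborel. h x y) = (LINT x|lborel. LINT y|lborel. h x y)"
    by (rule lborel_pair.Fubini_integral[OF h_int])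
  also have "\<dots> = (\<Sum>k<n. (LINT x|lborel. x ^ k *\<^sub>R f x) * (LINT z|lborel. D k z * w z) / fact k)"
  proof -
    have "integrable lborel (\<lambda>x. (x ^ k *\<^sub>R f x) * (LINT z|lborel. D k z * w z) / fact k)" if "k < n" for k
      by (intro integrable_divide integrable_mult_left f that)
    then show ?thesis
      unfolding h_y by (simp add: Bochner_Integration.integral_sum del: mult_scaleR_left)
  qed
  also have "\<dots> = (LINT z|lborel. (\<Sum>k<n. (LINT x|lborel. x ^ k *\<^sub>R f x) / fact k * (D k z * w z)))"
    by (subst Bochner_Integration.integral_sum) (auto intro!: integrable_mult_right D_int)
  also have "\<dots> = (LINT z|lborel. poly (deriv_series n (\<lambda>k. (LINT x|lborel. x ^ k *\<^sub>R f x) / fact k) P) (of_real z) * w z)"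
    by (simp only: deriv_series_def D_def poly_sum poly_smult sum_distrib_right mult.assoc)
  finally show ?thesis
    using lborel_pair.integrable_snd[OF h_int] unfolding has_bochner_integral_iff x_int by simp
qed

lemma bounded_if_integrable_deriv:
  fixes f f' :: "real \<Rightarrow> real"
  assumes f: "\<And>x. (f has_real_derivative f' x) (at x)"
    and f': "integrable lborel f'"
  shows "\<exists>B. \<forall>x. \<bar>f x\<bar> \<le> B"
proof -
  let ?I = "LINT x|lborel. \<bar>f' x\<bar>"
  have inc: "\<bar>f b - f a\<bar> \<le> ?I" if "a \<le> b" for a b
  proof -
    have si: "set_integrable lborel {a..b} f'"
      by (rule set_integrable_subset[of lborel UNIV]) (use f' in \<open>auto simp: set_integrable_def\<close>)
    have "(f' has_integral (f b - f a)) {a..b}"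
      using that f by (intro fundamental_theorem_of_calculus)
        (auto simp: has_real_derivative_iff_has_vector_derivative[symmetric] intro: has_field_derivative_at_within)
    then have "f b - f a = (LINT x:{a..b}|lborel. f' x)"
      using set_borel_integral_eq_integral(2)[OF si] by (simp add: integral_unique)
    also have "\<bar>\<dots>\<bar> \<le> (LINT x|lborel. \<bar>indicator {a..b} x *\<^sub>R f' x\<bar>)"
      unfolding set_lebesgue_integral_def by (rule integral_abs_bound)
    also have "\<dots> \<le> ?I"
      using f' si unfolding set_integrable_def
      by (intro integral_mono integrable_abs) (auto simp: indicator_def)
    finally show ?thesis .
  qed
  have "\<bar>f x\<bar> \<le> \<bar>f 0\<bar> + ?I" for x
    using inc[of 0 x] inc[of x 0] by (cases "0 \<le> x") auto
  then show ?thesis by blast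
qed

text \<open>With this bound the convolution with an integrable function exists at every point and
  not merely almost everywhere, which the pointwise identity between the kernels requires.\<close>

lemma L1_F_bounded:
  assumes "f \<in> L1_F n" "2 \<le> n"
  shows "\<exists>B. \<forall>x. \<bar>f x\<bar> \<le> B"
proof (rule bounded_if_integrable_deriv)
  have "\<forall>j. j + 1 < n \<longrightarrow> (\<forall>x. (deriv ^^ j) f differentiable (at x))"
    using assms unfolding L1_F_def by blast
  from this[rule_format, of 0] assms(2) have "f differentiable (at x)" for x
    by simp
  then show "(f has_real_derivative deriv f x) (at x)" for x
    by (simp add: DERIV_deriv_iff_real_differentiable)
  define g where "g x = \<bar>x\<bar> powr (1 - 1) * (deriv ^^ 1) f x" for x :: real
  have g: "integrable lborel g"
  proof -
    have "\<forall>\<kappa>\<in>{1..real n}. \<forall>j<n. integrable lborel (\<lambda>x. (\<bar>x\<bar> powr (\<kappa> - 1)) * (deriv ^^ j) f x)"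
      using assms(1) unfolding L1_F_def by blast
    from this[rule_format, of 1 1] assms(2) show ?thesis
      unfolding g_def by simp
  qed
  then have [measurable]: "g \<in> borel_measurable borel" by auto
  have eq: "deriv f = (\<lambda>x. if x = 0 then deriv f 0 else g x)"
    by (auto simp: g_def fun_eq_iff)
  have "deriv f \<in> borel_measurable lborel"
    by (subst eq) measurable
  moreover have "AE x in lborel. g x = deriv f x"
    using AE_lborel_singleton[of "0::real"] by eventually_elim (simp add: eq)
  ultimately show "integrable lborel (deriv f)"
    by (rule integrable_cong_AE_imp[OF g])
qed

lemma conv_flip: "conv f g y = (LINT z|lborel. complex_of_real (f (y - z)) * g z)"
  unfolding conv_def
  by (subst lborel_integral_real_affine[of "-1" _ y]) simp_all

lemma integrable_bounded_shift_mult: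
  fixes g :: "real \<Rightarrow> complex"
  assumes f: "integrable lborel f" "\<And>x. \<bar>f x\<bar> \<le> B" and g: "integrable lborel g"
  shows "integrable lborel (\<lambda>z. complex_of_real (f (y - z)) * g z)"
proof (rule Bochner_Integration.integrable_bound)
  show "integrable lborel (\<lambda>z. B * norm (g z))" using g by simp
  have [measurable]: "f \<in> borel_measurable borel" "g \<in> borel_measurable borel" using f g by auto
  show "(\<lambda>z. complex_of_real (f (y - z)) * g z) \<in> borel_measurable lborel" by measurable
  show "AE z in lborel. norm (complex_of_real (f (y - z)) * g z) \<le> norm (B * norm (g z))"
  proof (rule AE_I2)
    fix z
    have "0 \<le> B" using f(2)[of 0] by simp
    with f(2)[of "y - z"] show "norm (complex_of_real (f (y - z)) * g z) \<le> norm (B * norm (g z))"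
      by (simp add: norm_mult mult_right_mono)
  qed
qed

section \<open>The bi-orthonormal pair and the kernel of the sum\<close>

theorem mainTheorem3:
  fixes n :: nat
    and M :: "'a measure"
    and X1 X2 :: "'a \<Rightarrow> complex mat"
    and \<omega> :: "real \<Rightarrow> real"
    and w pt p q :: "nat \<Rightarrow> real \<Rightarrow> complex"
    and Kt :: "real \<Rightarrow> real \<Rightarrow> complex"
    and pD :: "(nat \<Rightarrow> real) \<Rightarrow> complex"
  assumes "n \<ge> 1"
    and "prob_space M"
    and "polya_ensemble n M X1 \<omega>"
    and "polynomial_ensemble n M X2 w"
    and "prob_space.indep_var M (herm_lebesgue n) X1 (herm_lebesgue n) X2"
    and "described_by n w pt (\<lambda>j. w (j + 1))"
  defines "Kt \<equiv> kernel n pt (\<lambda>j. w (j + 1))"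
    and "pD \<equiv> ensemble_density n (norm_const n w / fourier \<omega> 0 ^ n) (\<lambda>b. conv \<omega> (w b))"
    and "p \<equiv> (\<lambda>j y'. LBINT r:{0..}. exp (- r) *\<^sub>R
           ((diff_op r ^^ (n - 1)) (\<lambda>t y. pt j y / fourier \<omega> t) 0 y' / fact (n - 1)))"
    and "q \<equiv> (\<lambda>j. conv \<omega> (w (j + 1)))"
  assumes "has_eigenvalue_density n M (\<lambda>x. X1 x + X2 x) pD"
  shows "described_by n (\<lambda>b. conv \<omega> (w b)) p q \<and>
    (\<forall>y' y. kernel n p q y' y =
       (LBINT yh. LBINT r:{0..}. (exp (- r) * \<omega> (y - yh)) *\<^sub>R
          ((diff_op r ^^ (n - 1)) (\<lambda>t z. Kt z yh / fourier \<omega> t) 0 y' / fact (n - 1))))"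
proof -
  note n = \<open>n \<ge> 1\<close>
  have \<omega>: "\<omega> \<in> L1_F n" "norm_const n (polya_weights \<omega>) \<noteq> 0"
    using assms(3) unfolding polya_ensemble_def polynomial_ensemble_def by auto
  then have \<omega>_int: "integrable lborel \<omega>" and \<omega>_nonneg: "0 \<le> \<omega> x" for x
    unfolding L1_F_def by auto
  define f where "f x = complex_of_real (\<omega> x)" for x
  have f_int: "integrable lborel (\<lambda>x. x ^ k *\<^sub>R f x)" if "k < n" for k
    using integrable_of_real[OF L1_moments_power[OF L1_F_imp_L1_moments[OF \<omega>(1) n] that], where 'a = complex]
    by (simp add: f_def scaleR_conv_of_real)
  have w_int: "integrable lborel (\<lambda>x. x ^ k *\<^sub>R w (j + 1) x)" if "k < n" "j < n" for k j
    using assms(4) that unfolding polynomial_ensemble_def by (intro L1_moments_power) auto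

  define F where "F k s = (LINT x|lborel. \<i> ^ k * (x ^ k *\<^sub>R f x) * exp (\<i> * complex_of_real (x * s)))"
    for k s
  have F0: "fourier \<omega> = F 0"
    by (simp add: fun_eq_iff fourier_def F_def f_def)
  have F: "(F k has_vector_derivative F (Suc k) t) (at t)" if "k < n - 1" for k t
  proof -
    have "integrable lborel (\<lambda>x. \<i> ^ k * (x ^ k *\<^sub>R f x))"
      by (intro integrable_mult_right f_int) (use that in simp)
    moreover have "integrable lborel (\<lambda>x. \<i> ^ k * (x ^ Suc k *\<^sub>R f x))"
      by (intro integrable_mult_right f_int) (use that in simp)
    then have "integrable lborel (\<lambda>x. x *\<^sub>R (\<i> ^ k * (x ^ k *\<^sub>R f x)))"
      by simp
    ultimately have "(F k has_vector_derivative (LINT x|lborel. \<i> * complex_of_real x * (\<i> ^ k * (x ^ k *\<^sub>R f x)) *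
        exp (\<i> * complex_of_real (x * t)))) (at t)"
      unfolding F_def by (rule has_vector_derivative_fourier_integral)
    also have "(\<lambda>x. \<i> * complex_of_real x * (\<i> ^ k * (x ^ k *\<^sub>R f x)) * exp (\<i> * complex_of_real (x * t))) =
        (\<lambda>x. \<i> ^ Suc k * (x ^ Suc k *\<^sub>R f x) * exp (\<i> * complex_of_real (x * t)))"
      by (simp add: fun_eq_iff scaleR_conv_of_real)
    finally show ?thesis unfolding F_def .
  qed
  have F00: "F 0 0 \<noteq> 0"
    unfolding F0[symmetric] using fourier_0_nonzero[OF \<omega>_int \<omega>_nonneg n \<omega>(2)] .

  define c where "c l = (-\<i>) ^ l * egf_inverse (\<lambda>k. F k 0) l / fact l" for l
  define d where "d k = (LINT x|lborel. x ^ k *\<^sub>R f x) / fact k" for k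
  have d: "d k = (-\<i>) ^ k * F k 0 / fact k" for k
  proof -
    have "F k 0 = \<i> ^ k * (LINT x|lborel. x ^ k *\<^sub>R f x)"
      by (simp add: F_def del: mult_scaleR_right)
    then have "(-\<i>) ^ k * F k 0 = (LINT x|lborel. x ^ k *\<^sub>R f x)"
      by (simp add: mult.assoc[symmetric] flip: power_mult_distrib)
    then show ?thesis by (simp add: d_def)
  qed
  \<comment> \<open>The Taylor series of \<open>F 0\<close> at \<open>0\<close> in the variable \<open>-\<i> X\<close> is \<open>d\<close>, and that of \<open>1 / F 0\<close> is \<open>c\<close>.\<close>
  have cd: "(\<Sum>k\<le>m. c k * d (m - k)) = (if m = 0 then 1 else 0)" for m
  proof -
    have "(\<Sum>k\<le>m. c k * d (m - k)) =
      (\<Sum>k\<le>m. (-\<i>) ^ m / fact m * (of_nat (m choose k) * F (m - k) 0 * egf_inverse (\<lambda>k. F k 0) k))"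
    proof (intro sum.cong refl)
      fix k assume "k \<in> {..m}"
      then have k: "k \<le> m" by simp
      then have "(-\<i>) ^ m = (-\<i>) ^ k * (-\<i>) ^ (m - k)" by (simp flip: power_add)
      with k show "c k * d (m - k) =
          (-\<i>) ^ m / fact m * (of_nat (m choose k) * F (m - k) 0 * egf_inverse (\<lambda>k. F k 0) k)"
        by (simp add: c_def d binomial_fact)
    qed
    also have "\<dots> = (if m = 0 then 1 else 0)"
      by (simp only: sum_distrib_left[symmetric] egf_inverse_conv[where a = "\<lambda>k. F k 0", OF F00]) simp
    finally show ?thesis .
  qed
  have dc: "(\<Sum>k\<le>m. d k * c (m - k)) = (if m = 0 then 1 else 0)" for m
    unfolding cd[symmetric]
    by (rule sum.reindex_bij_witness[of _ "\<lambda>k. m - k" "\<lambda>k. m - k"]) auto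

  have "\<exists>Q. Polynomial.degree Q < n \<and> (\<forall>y. pt j y = poly Q (complex_of_real y))" if "j < n" for j
  proof -
    have "pt j \<in> lin_span {..<n} pt" using that by (intro lin_span_base) auto
    also have "\<dots> = {\<lambda>y. poly Q (complex_of_real y) | Q. Polynomial.degree Q < n}"
      using assms(6) lin_span_monomials[OF n] unfolding described_by_def by simp
    finally show ?thesis by auto
  qed
  then obtain P where P_deg: "\<And>j. j < n \<Longrightarrow> Polynomial.degree (P j) < n"
    and P: "\<And>j y. j < n \<Longrightarrow> pt j y = poly (P j) (complex_of_real y)"
    by metis
  have eval: "(LBINT r:{0..}. exp (- r) *\<^sub>R
      ((diff_op r ^^ (n - 1)) (\<lambda>t z. poly Q (complex_of_real z) / F 0 t) 0 y / fact (n - 1))) =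
      poly (deriv_series n c Q) (complex_of_real y)" for Q y
    unfolding c_def by (rule integral_exp_diff_op[OF F F00 n])
  have p: "p j y = poly (deriv_series n c (P j)) (complex_of_real y)" if "j < n" for j y
    unfolding p_def F0 P[OF that] by (rule eval)

  have span_cong: "lin_span {..<n} g = lin_span {..<n} h" if "\<And>j y. j < n \<Longrightarrow> g j y = h j y" for g h
    unfolding lin_span_def using that by simp
  have biorth: "has_bochner_integral lborel (\<lambda>y. p l y * q m y) (if l = m then 1 else 0)"
    if "l < n" "m < n" for l m
  proof -
    have "has_bochner_integral lborel
        (\<lambda>y. poly (deriv_series n c (P l)) (of_real y) * (LINT x|lborel. f x * w (m + 1) (y - x)))
        (LINT z|lborel. poly (deriv_series n d (deriv_series n c (P l))) (of_real z) * w (m + 1) z)"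
      unfolding d_def
      by (rule has_bochner_integral_poly_conv[OF f_int w_int[OF _ that(2)] degree_deriv_series[OF P_deg[OF that(1)]]])
    also have "deriv_series n d (deriv_series n c (P l)) = P l"
      by (rule deriv_series_inverse[OF dc P_deg[OF that(1)]])
    also have "(LINT z|lborel. poly (P l) (of_real z) * w (m + 1) z) = (if l = m then 1 else 0)"
      using assms(6) that unfolding described_by_def P[OF that(1), symmetric]
      by (intro has_bochner_integral_integral_eq) blast
    finally show ?thesis
      unfolding p[OF that(1)] q_def conv_def f_def .
  qed
  have "lin_span {..<n} p = lin_span {..<n} (\<lambda>j y. poly (deriv_series n c (P j)) (complex_of_real y))"
    by (rule span_cong) (rule p)
  also have "\<dots> = lin_span {..<n} (\<lambda>j y. complex_of_real y ^ j)"
  proof (rule lin_span_deriv_series[OF n _ P_deg deriv_series_inverse[OF cd]])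
    have "lin_span {..<n} (\<lambda>j y. poly (P j) (complex_of_real y)) = lin_span {..<n} pt"
      by (rule span_cong) (simp add: P)
    then show "lin_span {..<n} (\<lambda>j y. poly (P j) (complex_of_real y)) = lin_span {..<n} (\<lambda>j y. complex_of_real y ^ j)"
      using assms(6) unfolding described_by_def by simp
  qed
  finally have desc: "described_by n (\<lambda>b. conv \<omega> (w b)) p q"
    unfolding described_by_def using biorth by (simp add: q_def)

  have "kernel n p q y' y =
       (LBINT yh. LBINT r:{0..}. (exp (- r) * \<omega> (y - yh)) *\<^sub>R
          ((diff_op r ^^ (n - 1)) (\<lambda>t z. Kt z yh / fourier \<omega> t) 0 y' / fact (n - 1)))" for y' y
  proof -
    have inner: "(LBINT r:{0..}. (exp (- r) * \<omega> (y - yh)) *\<^sub>R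
          ((diff_op r ^^ (n - 1)) (\<lambda>t z. Kt z yh / fourier \<omega> t) 0 y' / fact (n - 1))) =
        (\<Sum>j<n. p j y' * (complex_of_real (\<omega> (y - yh)) * w (j + 1) yh))" for yh
    proof -
      define Q where "Q = (\<Sum>j<n. Polynomial.smult (w (j + 1) yh) (P j))"
      have Kt: "Kt z yh = poly Q (complex_of_real z)" for z
        by (simp add: Kt_def kernel_def Q_def poly_sum P mult.commute)
      have "(LBINT r:{0..}. (exp (- r) * \<omega> (y - yh)) *\<^sub>R
          ((diff_op r ^^ (n - 1)) (\<lambda>t z. Kt z yh / fourier \<omega> t) 0 y' / fact (n - 1))) =
        \<omega> (y - yh) *\<^sub>R (LBINT r:{0..}. exp (- r) *\<^sub>R
          ((diff_op r ^^ (n - 1)) (\<lambda>t z. poly Q (complex_of_real z) / F 0 t) 0 y' / fact (n - 1)))"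
        unfolding Kt F0 set_lebesgue_integral_def integral_scaleR_right[symmetric]
        by (simp only: scaleR_scaleR mult_ac)
      also have "\<dots> = \<omega> (y - yh) *\<^sub>R poly (deriv_series n c Q) (of_real y')"
        by (simp only: eval)
      also have "\<dots> = (\<Sum>j<n. p j y' * (complex_of_real (\<omega> (y - yh)) * w (j + 1) yh))"
        unfolding Q_def deriv_series_sum deriv_series_smult poly_sum poly_smult scaleR_conv_of_real
          sum_distrib_left by (intro sum.cong refl) (simp add: p mult_ac)
      finally show ?thesis .
    qed
    have "kernel n p q y' y = (\<Sum>j<n. p j y' * (LINT yh|lborel. complex_of_real (\<omega> (y - yh)) * w (j + 1) yh))"
      by (simp add: kernel_def q_def conv_flip)
    also have "\<dots> = (LINT yh|lborel. (\<Sum>j<n. p j y' * (complex_of_real (\<omega> (y - yh)) * w (j + 1) yh)))"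
    \<comment> \<open>If \<open>n = 1\<close>, the convolution need not exist at \<open>y\<close>, but both sides are
      the same multiple of one integral, whatever its default value.\<close>
    proof (cases "n = 1")
      case True
      then show ?thesis by simp
    next
      case False
      with n have "2 \<le> n" by simp
      with L1_F_bounded[OF \<omega>(1)] obtain B where B: "\<And>x. \<bar>\<omega> x\<bar> \<le> B" by blast
      have "integrable lborel (\<lambda>yh. complex_of_real (\<omega> (y - yh)) * w (j + 1) yh)" if "j < n" for j
        using w_int[of 0 j] n that by (intro integrable_bounded_shift_mult[OF \<omega>_int B]) simp
      then show ?thesis
        by (subst Bochner_Integration.integral_sum) auto
    qed
    finally show ?thesis unfolding inner .
  qed
  with desc show ?thesis by blast
qed

end
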